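(* Let $\Phi:\mathbb{M}(n)\to\mathbb{M}(k)$ be a positive unital linear map. Let $A\in\mathbb{M}(n)$ be a Hermitian matrix whose spectrum is contained in the real interval $[m,M]$. Then for every $r=0,1,2,\ldots$, $$\left[\Phi\left(A^{i+j-2}(A-mI)(MI-A)\right)\right]_{1\le i,j\le r+1}\ge O.$$
   Context: $\mathbb{M}(n)$ is the $C^*$-algebra of all $n\times n$ complex matrices. A linear map $\Phi:\mathbb{M}(n)\to\mathbb{M}(k)$ is positive if it sends positive semidefinite matrices to positive semidefinite matrices, and unital if $\Phi(I)=I$. $[X_{ij}]_{1\le i,j\le r+1}$ with $X_{ij}\in\mathbb{M}(k)$ denotes the $(r+1)\times(r+1)$ block matrix with blocks $X_{ij}$, viewed as an element of $\mathbb{M}((r+1)k)$. $X\ge O$ means $X$ is Hermitian positive semidefinite. $A^0=I$. *)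

theory Defs
  imports "Jordan_Normal_Form.Spectral_Radius" "Jordan_Normal_Form.VS_Connect"
begin

definition hermitian_mat :: "complex mat \<Rightarrow> bool" where
  "hermitian_mat X \<longleftrightarrow> mat_adjoint X = X"

lemma hermitian_mat_iff:
  assumes "X \<in> carrier_mat n n"
  shows "hermitian_mat X \<longleftrightarrow> (\<forall>i<n. \<forall>j<n. X $$ (j, i) = cnj (X $$ (i, j)))"
proof -
  have "mat_adjoint X = mat n n (\<lambda>(i, j). cnj (X $$ (j, i)))"
    using assms by (intro eq_matI) (auto simp: mat_adjoint_def mat_of_rows_def)
  then have "hermitian_mat X \<longleftrightarrow> (\<forall>i<n. \<forall>j<n. cnj (X $$ (j, i)) = X $$ (i, j))"
    using assms unfolding hermitian_mat_def mat_eq_iff by simp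
  then show ?thesis
    by metis
qed

text \<open>\<^term>\<open>x \<bullet>c y\<close> conjugates its second argument, so the form below is
  $\sum_{a,b} \overline{v_a} X_{ab} v_b$, which is real for Hermitian \<^term>\<open>X\<close>.\<close>

definition psd_mat :: "complex mat \<Rightarrow> bool" where
  "psd_mat X \<longleftrightarrow> hermitian_mat X \<and>
     (\<forall>v \<in> carrier_vec (dim_row X). 0 \<le> Re ((X *\<^sub>v v) \<bullet>c v))"

abbreviation linear_mat_map ::
    "nat \<Rightarrow> nat \<Rightarrow> (complex mat \<Rightarrow> complex mat) \<Rightarrow> bool" where
  "linear_mat_map n k \<equiv>
     linear_map class_ring (module_mat TYPE(complex) n n) (module_mat TYPE(complex) k k)"

lemma linear_mat_map_iff:
  "linear_mat_map n k \<Phi> \<longleftrightarrow>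
     (\<forall>X \<in> carrier_mat n n. \<Phi> X \<in> carrier_mat k k) \<and>
     (\<forall>X \<in> carrier_mat n n. \<forall>Y \<in> carrier_mat n n. \<Phi> (X + Y) = \<Phi> X + \<Phi> Y) \<and>
     (\<forall>c. \<forall>X \<in> carrier_mat n n. \<Phi> (c \<cdot>\<^sub>m X) = c \<cdot>\<^sub>m \<Phi> X)"
proof -
  have vs: "vectorspace class_ring (module_mat TYPE(complex) m m)" for m
    by (rule matrix_vs)
  then have md: "module class_ring (module_mat TYPE(complex) m m)" for m
    unfolding vectorspace_def by blast
  have "linear_mat_map n k \<Phi> \<longleftrightarrow>
      \<Phi> \<in> module_hom class_ring (module_mat TYPE(complex) n n) (module_mat TYPE(complex) k k)"
    unfolding linear_map_def mod_hom_def mod_hom_axioms_def using vs md by blast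
  also have "\<dots> \<longleftrightarrow>
     (\<forall>X \<in> carrier_mat n n. \<Phi> X \<in> carrier_mat k k) \<and>
     (\<forall>X \<in> carrier_mat n n. \<forall>Y \<in> carrier_mat n n. \<Phi> (X + Y) = \<Phi> X + \<Phi> Y) \<and>
     (\<forall>c. \<forall>X \<in> carrier_mat n n. \<Phi> (c \<cdot>\<^sub>m X) = c \<cdot>\<^sub>m \<Phi> X)"
    unfolding module_hom_def module_mat_simps mem_Collect_eq Pi_iff partial_object.simps by blast
  finally show ?thesis .
qed

definition positive_mat_map ::
    "nat \<Rightarrow> (complex mat \<Rightarrow> complex mat) \<Rightarrow> bool" where
  "positive_mat_map n \<Phi> \<longleftrightarrow> (\<forall>X \<in> carrier_mat n n. psd_mat X \<longrightarrow> psd_mat (\<Phi> X))"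

definition unital_mat_map ::
    "nat \<Rightarrow> nat \<Rightarrow> (complex mat \<Rightarrow> complex mat) \<Rightarrow> bool" where
  "unital_mat_map n k \<Phi> \<longleftrightarrow> \<Phi> (1\<^sub>m n) = 1\<^sub>m k"

text \<open>Blocks are indexed from 1, as in $[X_{ij}]_{1 \le i,j \le p}$, whereas matrix entries
  are indexed from 0; every block is a $k \times k$ matrix.\<close>

definition block_mat :: "nat \<Rightarrow> nat \<Rightarrow> (nat \<Rightarrow> nat \<Rightarrow> complex mat) \<Rightarrow> complex mat" where
  "block_mat p k X =
     mat (p * k) (p * k) (\<lambda>(a, b). X (a div k + 1) (b div k + 1) $$ (a mod k, b mod k))"

end

(* Diagonalize A = U diag(e) U^* and let E_l be the rank-one projection onto the l-th column of U.
   Then A^q (A - mI)(MI - A) is the sum over l of e_l^q (e_l - m)(M - e_l) E_l, so the quadratic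
   form of the block matrix at v = (v_1, ..., v_(r+1)) is
     sum_l (e_l - m)(M - e_l) <Phi(E_l) w_l, w_l>   with   w_l = sum_i e_l^(i-1) v_i,
   because e_l^(i+j-2) factors as e_l^(i-1) e_l^(j-1). Every Phi(E_l) is positive semidefinite. *)

theory Submission
  imports Defs
begin

section \<open>Adjoints of complex matrices, entry by entry\<close>

lemma mat_adjoint_conv_mat:
  fixes X :: "complex mat"
  shows "mat_adjoint X = mat (dim_col X) (dim_row X) (\<lambda>(i, j). cnj (X $$ (j, i)))"
  by (intro eq_matI) (auto simp: mat_adjoint_def mat_of_rows_def)

lemma mat_adjoint_dim [simp]:
  fixes X :: "complex mat"
  shows "dim_row (mat_adjoint X) = dim_col X" "dim_col (mat_adjoint X) = dim_row X"
  by (simp_all add: mat_adjoint_conv_mat)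

lemma mat_adjoint_carrier [simp]:
  fixes X :: "complex mat"
  shows "X \<in> carrier_mat p q \<Longrightarrow> mat_adjoint X \<in> carrier_mat q p"
  by (auto simp: mat_adjoint_conv_mat)

lemma mat_adjoint_mult:
  fixes X Y :: "complex mat"
  assumes "X \<in> carrier_mat p q" "Y \<in> carrier_mat q s"
  shows "mat_adjoint (X * Y) = mat_adjoint Y * mat_adjoint X"
  using assms
  by (intro eq_matI) (auto simp: mat_adjoint_conv_mat scalar_prod_def mult.commute)

lemma mat_adjoint_mult_index:
  fixes X :: "complex mat"
  assumes "X \<in> carrier_mat p q" "i < q" "j < q"
  shows "(mat_adjoint X * X) $$ (i, j) = (\<Sum>k<p. cnj (X $$ (k, i)) * X $$ (k, j))"
  using assms by (simp add: mat_adjoint_conv_mat scalar_prod_def atLeast0LessThan)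

lemma mat_adjoint_adjoint [simp]:
  fixes X :: "complex mat"
  shows "mat_adjoint (mat_adjoint X) = X"
  by (intro eq_matI) (auto simp: mat_adjoint_conv_mat)

lemma mat_adjoint_four_block_mat:
  fixes A B C D :: "complex mat"
  assumes "A \<in> carrier_mat p q" "B \<in> carrier_mat p s" "C \<in> carrier_mat t q" "D \<in> carrier_mat t s"
  shows "mat_adjoint (four_block_mat A B C D)
       = four_block_mat (mat_adjoint A) (mat_adjoint C) (mat_adjoint B) (mat_adjoint D)"
  using assms by (intro eq_matI) (auto simp: mat_adjoint_conv_mat)

section \<open>Spectral theorem for Hermitian matrices by unitary deflation\<close>

lemma cscalar_prod_eq_norm:
  fixes v :: "complex vec"
  shows "v \<bullet>c v = complex_of_real (\<Sum>i<dim_vec v. (cmod (v $ i))\<^sup>2)"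
proof -
  have "v \<bullet>c v = (\<Sum>i<dim_vec v. v $ i * cnj (v $ i))"
    by (simp add: scalar_prod_def atLeast0LessThan)
  then show ?thesis
    by (simp only: of_real_sum complex_norm_square)
qed

text \<open>Completing \<open>v\<close> to a basis and applying Gram-Schmidt gives an orthogonal
  basis that still starts with \<open>v\<close>; dividing each vector by its norm makes it
  orthonormal. The scalar \<open>c\<close> absorbs the normalisation of \<open>v\<close>.\<close>

lemma unitary_mat_with_first_col:
  fixes v :: "complex vec"
  assumes v: "v \<in> carrier_vec n" and v0: "v \<noteq> 0\<^sub>v n"
  obtains W c where "W \<in> carrier_mat n n" "mat_adjoint W * W = 1\<^sub>m n" "col W 0 = c \<cdot>\<^sub>v v"
proof -
  interpret cof_vec_space n "TYPE(complex)" .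
  define b where "b = basis_completion v"
  define ws where "ws = gram_schmidt n b"
  have n: "n \<noteq> 0"
    using v v0 by auto
  note bc = basis_completion[OF v v0, folded b_def]
  note gs = gram_schmidt_result[OF bc(2,4,5) ws_def]
  from bc(6,7) n obtain vs where "b = v # vs"
    by (cases b) auto
  then have hd: "hd ws = v"
    using gram_schmidt_hd[OF v] unfolding ws_def by simp
  have len: "length ws = n"
    using gs(4) bc(6) by simp
  \<comment> \<open>Gram-Schmidt only yields orthogonal vectors, so column \<open>j\<close> of
    \<open>W\<close> is divided by the Euclidean norm \<open>s j\<close>.\<close>
  define s where "s = (\<lambda>i. sqrt (\<Sum>k<n. (cmod (ws ! i $ k))\<^sup>2))"
  define W where "W = mat n n (\<lambda>(i, j). ws ! j $ i / complex_of_real (s j))"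
  have W: "W \<in> carrier_mat n n"
    unfolding W_def by simp
  have dim: "ws ! i \<in> carrier_vec n" if "i < n" for i
    using gs(3) len that by auto
  have orth: "ws ! i \<bullet>c ws ! j = 0 \<longleftrightarrow> i \<noteq> j" if "i < n" "j < n" for i j
    using gs(2) len that by (auto simp: corthogonalD)
  have sq: "ws ! i \<bullet>c ws ! i = (complex_of_real (s i))\<^sup>2" if "i < n" for i
  proof -
    have "(s i)\<^sup>2 = (\<Sum>k<n. (cmod (ws ! i $ k))\<^sup>2)"
      unfolding s_def by (simp add: sum_nonneg)
    then show ?thesis
      using dim[OF that] by (metis cscalar_prod_eq_norm carrier_vecD of_real_power)
  qed
  \<comment> \<open>For \<open>i = j\<close>, \<open>orth\<close> says that the self-product is
    nonzero, so division by \<open>s i\<close> is legitimate.\<close>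
  have s0: "s i \<noteq> 0" if "i < n" for i
    using sq[OF that] orth[OF that that] by auto
  have "mat_adjoint W * W = 1\<^sub>m n"
  proof (rule eq_matI)
    fix i j assume "i < dim_row (1\<^sub>m n)" "j < dim_col (1\<^sub>m n)"
    then have i: "i < n" and j: "j < n"
      by auto
    have "(mat_adjoint W * W) $$ (i, j) = (\<Sum>k<n. cnj (W $$ (k, i)) * W $$ (k, j))"
      by (rule mat_adjoint_mult_index[OF W i j])
    also have "\<dots> = (\<Sum>k<n. ws ! j $ k * cnj (ws ! i $ k)) / (complex_of_real (s i) * complex_of_real (s j))"
      using i j by (simp add: W_def sum_divide_distrib mult.commute)
    also have "(\<Sum>k<n. ws ! j $ k * cnj (ws ! i $ k)) = ws ! j \<bullet>c ws ! i"
      using dim[OF i] dim[OF j] by (simp add: scalar_prod_def atLeast0LessThan)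
    finally show "(mat_adjoint W * W) $$ (i, j) = 1\<^sub>m n $$ (i, j)"
      using i j orth[OF j i] sq[OF i] s0[OF i] by (auto simp: power2_eq_square)
  qed (use W in auto)
  moreover have "ws ! 0 = v"
    using hd len n by (cases ws) auto
  then have "col W 0 = (1 / complex_of_real (s 0)) \<cdot>\<^sub>v v"
    using n v by (intro eq_vecI) (auto simp: W_def)
  ultimately show thesis
    using that W by blast
qed

text \<open>Induction on the dimension by deflation: a unit eigenvector becomes the first column of
  a unitary matrix, conjugation splits off its eigenvalue, and the induction hypothesis diagonalizes
  the Hermitian block that remains. The values of \<open>e\<close> are complex here; that they are
  real is obtained later from the hypothesis on the spectrum.\<close>

lemma hermitian_mat_diagonalization:
  assumes "A \<in> carrier_mat n n" "hermitian_mat A"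
  shows "\<exists>U e. U \<in> carrier_mat n n \<and> mat_adjoint U * U = 1\<^sub>m n \<and> A = U * mat_diag n e * mat_adjoint U"
  using assms
proof (induction n arbitrary: A)
  case 0
  then show ?case
    by (intro exI[of _ "1\<^sub>m 0"] exI[of _ "\<lambda>_. 0"]) (auto intro!: eq_matI simp: mat_adjoint_conv_mat)
next
  case (Suc n)
  note A = Suc.prems(1)
  \<comment> \<open>The dimension is positive and the field is algebraically closed, so an
    eigenvalue exists.\<close>
  from spectrum_non_empty[OF A] obtain a where "eigenvalue A a"
    unfolding spectrum_def by auto
  then obtain v where v: "v \<in> carrier_vec (Suc n)" "v \<noteq> 0\<^sub>v (Suc n)" "A *\<^sub>v v = a \<cdot>\<^sub>v v"
    using A unfolding eigenvalue_def eigenvector_def by auto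
  obtain W c where W: "W \<in> carrier_mat (Suc n) (Suc n)" and WW: "mat_adjoint W * W = 1\<^sub>m (Suc n)"
    and W0: "col W 0 = c \<cdot>\<^sub>v v"
    by (rule unitary_mat_with_first_col[OF v(1,2)])
  have W': "mat_adjoint W \<in> carrier_mat (Suc n) (Suc n)"
    using W by simp
  have WW': "W * mat_adjoint W = 1\<^sub>m (Suc n)"
    by (rule mat_mult_left_right_inverse[OF W' W WW])
  define A' where "A' = mat_adjoint W * A * W"
  have A': "A' \<in> carrier_mat (Suc n) (Suc n)"
    unfolding A'_def by (intro mult_carrier_mat[of _ _ "Suc n"] W W' A)
  have "mat_adjoint A' = A'"
  proof -
    have "mat_adjoint A' = mat_adjoint W * (mat_adjoint A * mat_adjoint (mat_adjoint W))"
      unfolding A'_def mat_adjoint_mult[OF mult_carrier_mat[OF W' A] W] mat_adjoint_mult[OF W' A] ..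
    also have "mat_adjoint A = A"
      using Suc.prems(2) by (simp add: hermitian_mat_def)
    finally show ?thesis
      unfolding A'_def using W W' A by (simp add: assoc_mult_mat[of _ "Suc n" "Suc n" _ "Suc n" _ "Suc n"])
  qed
  then have herm: "A' $$ (i, j) = cnj (A' $$ (j, i))" if "i < Suc n" "j < Suc n" for i j
    using hermitian_mat_iff[OF A'] that unfolding hermitian_mat_def by blast
  have AW: "A *\<^sub>v col W 0 = a \<cdot>\<^sub>v col W 0"
    unfolding W0 using A v by (simp add: mult_mat_vec smult_smult_assoc mult.commute)
  \<comment> \<open>Since \<open>col W 0\<close> is an eigenvector, column 0 of \<open>A'\<close> is
    \<open>a\<close> times column 0 of \<open>mat_adjoint W * W\<close>, that is, of the
    identity.\<close>
  have col0: "A' $$ (i, 0) = (if i = 0 then a else 0)" if i: "i < Suc n" for i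
  proof -
    have "A' = mat_adjoint W * (A * W)"
      unfolding A'_def using W W' A by (simp add: assoc_mult_mat[of _ "Suc n" "Suc n" _ "Suc n" _ "Suc n"])
    then have "A' $$ (i, 0) = row (mat_adjoint W) i \<bullet> col (A * W) 0"
      using i W W' A by simp
    also have "col (A * W) 0 = A *\<^sub>v col W 0"
      by (rule col_mult2[OF A W]) simp
    also have "row (mat_adjoint W) i \<bullet> (A *\<^sub>v col W 0) = a * (mat_adjoint W * W) $$ (i, 0)"
      unfolding AW using i W W' by simp
    finally show ?thesis
      unfolding WW using i by simp
  qed
  define A3 where "A3 = mat n n (\<lambda>(i, j). A' $$ (Suc i, Suc j))"
  have A3: "A3 \<in> carrier_mat n n"
    by (simp add: A3_def)
  have "hermitian_mat A3"
    unfolding hermitian_mat_iff[OF A3]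
  proof (intro allI impI)
    fix i j assume "i < n" "j < n"
    then show "A3 $$ (j, i) = cnj (A3 $$ (i, j))"
      using herm[of "Suc j" "Suc i"] by (simp add: A3_def)
  qed
  from Suc.IH[OF A3 this] obtain V d where V: "V \<in> carrier_mat n n"
    and VV: "mat_adjoint V * V = 1\<^sub>m n" and A3V: "A3 = V * mat_diag n d * mat_adjoint V"
    by blast
  \<comment> \<open>\<open>Z\<close> is the direct sum of the 1 by 1 identity and \<open>V\<close>:
    it leaves the first coordinate alone and diagonalizes the complementary block. Accordingly
    \<open>e\<close> lists \<open>a\<close> first and then \<open>d\<close>, shifted by one.\<close>
  define Z where "Z = four_block_mat (1\<^sub>m 1) (0\<^sub>m 1 n) (0\<^sub>m n 1) V"
  define e where "e = (\<lambda>i. case i of 0 \<Rightarrow> a | Suc i \<Rightarrow> d i)"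
  have Z: "Z \<in> carrier_mat (Suc n) (Suc n)"
    unfolding Z_def using four_block_carrier_mat[OF one_carrier_mat[of 1] V] by simp
  have Z': "mat_adjoint Z \<in> carrier_mat (Suc n) (Suc n)"
    using Z by simp
  have V': "mat_adjoint V \<in> carrier_mat n n"
    using V by simp
  have adj1: "mat_adjoint (1\<^sub>m p) = (1\<^sub>m p :: complex mat)"
    and adj0: "mat_adjoint (0\<^sub>m p q) = (0\<^sub>m q p :: complex mat)" for p q
    by (auto intro!: eq_matI simp: mat_adjoint_conv_mat)
  have Zadj: "mat_adjoint Z = four_block_mat (1\<^sub>m 1) (0\<^sub>m 1 n) (0\<^sub>m n 1) (mat_adjoint V)"
    unfolding Z_def using V by (simp add: mat_adjoint_four_block_mat[of _ 1 1 _ n _ n] adj1 adj0)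
  have ZZ: "mat_adjoint Z * Z = 1\<^sub>m (Suc n)"
    unfolding Zadj unfolding Z_def using V V' VV
    by (subst mult_four_block_mat[of _ 1 1 _ n _ n _ _ 1 _ n]) (auto intro!: eq_matI)
  have D: "mat_diag (Suc n) e = four_block_mat (mat 1 1 (\<lambda>_. a)) (0\<^sub>m 1 n) (0\<^sub>m n 1) (mat_diag n d)"
    by (intro eq_matI) (auto simp: mat_diag_def e_def split: nat.splits)
  have Z1: "Z * mat_diag (Suc n) e = four_block_mat (mat 1 1 (\<lambda>_. a)) (0\<^sub>m 1 n) (0\<^sub>m n 1) (V * mat_diag n d)"
    unfolding D unfolding Z_def using V 
    by (subst mult_four_block_mat[of _ 1 1 _ n _ n _ _ 1 _ n])
      (auto simp: left_mult_zero_mat[OF mat_diag_dim])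
  have VD: "V * mat_diag n d \<in> carrier_mat n n"
    using V by (intro mult_carrier_mat) auto
  have "Z * mat_diag (Suc n) e * mat_adjoint Z
      = four_block_mat (mat 1 1 (\<lambda>_. a)) (0\<^sub>m 1 n) (0\<^sub>m n 1) A3"
    unfolding Z1 Zadj A3V using V' VD
    by (subst mult_four_block_mat[of _ 1 1 _ n _ n _ _ 1 _ n])
      (auto simp: left_mult_zero_mat[OF V'] right_mult_zero_mat[OF VD])
  also have "\<dots> = A'"
  proof -
    \<comment> \<open>Column 0 of \<open>A'\<close> vanishes below the corner; Hermitian symmetry
      carries this over to row 0, so \<open>A'\<close> is block diagonal.\<close>
    have "A' $$ (0, j) = 0" if "0 < j" "j < Suc n" for j
      using herm[of 0 j] col0[of j] that by simp
    then show ?thesis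
      using A' A3 col0 by (intro eq_matI) (auto simp: A3_def)
  qed
  finally have A'Z: "A' = Z * mat_diag (Suc n) e * mat_adjoint Z" ..
  define U where "U = W * Z"
  note assoc = assoc_mult_mat[of _ "Suc n" "Suc n" _ "Suc n" _ "Suc n"]
  note mc = mult_carrier_mat[of _ "Suc n" "Suc n" _ "Suc n"]
  have U: "U \<in> carrier_mat (Suc n) (Suc n)"
    unfolding U_def by (rule mc[OF W Z])
  have Uadj: "mat_adjoint U = mat_adjoint Z * mat_adjoint W"
    unfolding U_def by (rule mat_adjoint_mult[OF W Z])
  have "mat_adjoint U * U = mat_adjoint Z * ((mat_adjoint W * W) * Z)"
    unfolding Uadj unfolding U_def using W W' Z Z' by (simp add: assoc mc)
  then have UU: "mat_adjoint U * U = 1\<^sub>m (Suc n)"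
    using Z by (simp add: WW ZZ)
  have "W * A' * mat_adjoint W = (W * mat_adjoint W) * A * (W * mat_adjoint W)"
    unfolding A'_def using W W' A by (simp add: assoc mc)
  then have "A = W * A' * mat_adjoint W"
    using A by (simp add: WW')
  also have "\<dots> = U * mat_diag (Suc n) e * mat_adjoint U"
    unfolding A'Z Uadj unfolding U_def using W W' Z Z' by (simp add: assoc mc)
  finally show ?case
    using U UU by blast
qed

section \<open>Quadratic forms and positivity of block matrices\<close>

lemma mult_mat_diag_adjoint_index:
  assumes U: "U \<in> carrier_mat n n" and "a < n" "b < n"
  shows "(U * mat_diag n c * mat_adjoint U) $$ (a, b) = (\<Sum>l<n. c l * (U $$ (a, l) * cnj (U $$ (b, l))))"
  using assms
  by (simp add: mat_diag_mult_right[OF U] mat_adjoint_conv_mat scalar_prod_def atLeast0LessThan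
      mult_ac)

lemma cscalar_prod_mult_mat_vec:
  fixes X :: "complex mat"
  assumes "X \<in> carrier_mat p p" "v \<in> carrier_vec p"
  shows "(X *\<^sub>v v) \<bullet>c v = (\<Sum>x<p. \<Sum>y<p. cnj (v $ x) * X $$ (x, y) * v $ y)"
  using assms
  by (simp add: scalar_prod_def atLeast0LessThan sum_distrib_left sum_distrib_right mult_ac)

text \<open>The form of \<open>u u^*\<close> at \<open>v\<close> is the squared modulus of the sum
  of \<open>cnj (v $ x) * u x\<close>.\<close>

lemma psd_mat_rank_one:
  fixes u :: "nat \<Rightarrow> complex"
  assumes X: "X \<in> carrier_mat p p" and "\<And>a b. a < p \<Longrightarrow> b < p \<Longrightarrow> X $$ (a, b) = u a * cnj (u b)"
  shows "psd_mat X"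
  unfolding psd_mat_def
proof (intro conjI ballI)
  show "hermitian_mat X"
    unfolding hermitian_mat_iff[OF X] using assms(2) by simp
  fix v :: "complex vec" assume "v \<in> carrier_vec (dim_row X)"
  then have v: "v \<in> carrier_vec p"
    using X by simp
  define z where "z = (\<Sum>x<p. cnj (v $ x) * u x)"
  have "(X *\<^sub>v v) \<bullet>c v = (\<Sum>x<p. \<Sum>y<p. (cnj (v $ x) * u x) * (cnj (u y) * v $ y))"
    unfolding cscalar_prod_mult_mat_vec[OF X v] using assms(2)
    by (intro sum.cong) (auto simp: mult_ac)
  also have "\<dots> = z * cnj z"
    unfolding z_def by (simp add: sum_product mult_ac)
  finally show "0 \<le> Re ((X *\<^sub>v v) \<bullet>c v)"
    by (simp add: complex_mult_cnj)
qed

text \<open>An index below \<open>p * k\<close> is uniquely \<open>i * k + a\<close> with block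
  number \<open>i < p\<close> and offset \<open>a < k\<close>; this splitting matches the layout of
  \<open>block_mat\<close>.\<close>

lemma sum_lessThan_mult:
  fixes p k :: nat
  shows "(\<Sum>x<p * k. h x) = (\<Sum>i<p. \<Sum>a<k. h (i * k + a))"
proof -
  have "(\<Sum>x<p * k. h x) = (\<Sum>i<p. sum h {i * k..<i * k + k})"
    by (rule sum.nat_group[symmetric])
  also have "\<dots> = (\<Sum>i<p. \<Sum>a<k. h (i * k + a))"
  proof (rule sum.cong[OF refl])
    fix i
    show "sum h {i * k..<i * k + k} = (\<Sum>a<k. h (i * k + a))"
      using sum.shift_bounds_nat_ivl[of h 0 "i * k" k]
      by (simp add: add.commute atLeast0LessThan)
  qed
  finally show ?thesis .
qed

text \<open>The block matrix is the sum over \<open>l\<close> of \<open>c l\<close> times the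
  Kronecker product of the real rank-one matrix with entries \<open>z l i * z l j\<close> and
  \<open>G l\<close>. Pulling the weights \<open>z l i\<close> into the vector turns its form into a
  nonnegative combination of the forms of the \<open>G l\<close>.\<close>

lemma psd_block_mat_sum:
  fixes c :: "nat \<Rightarrow> real" and z :: "nat \<Rightarrow> nat \<Rightarrow> real"
  assumes c: "\<And>l. l < n \<Longrightarrow> 0 \<le> c l"
    and G: "\<And>l. l < n \<Longrightarrow> G l \<in> carrier_mat k k" "\<And>l. l < n \<Longrightarrow> psd_mat (G l)"
    and X: "\<And>i j a b. i < p \<Longrightarrow> j < p \<Longrightarrow> a < k \<Longrightarrow> b < k \<Longrightarrow>
      X (i + 1) (j + 1) $$ (a, b) = (\<Sum>l<n. complex_of_real (c l * z l i * z l j) * G l $$ (a, b))"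
  shows "psd_mat (block_mat p k X)"
proof -
  let ?B = "block_mat p k X"
  have B: "?B \<in> carrier_mat (p * k) (p * k)"
    by (simp add: block_mat_def)
  \<comment> \<open>For \<open>k = 0\<close> the range of \<open>x\<close> is empty, so the claim is
    vacuous.\<close>
  have dm: "x div k < p" "x mod k < k" if "x < p * k" for x
    using that by (cases "k = 0"; simp add: less_mult_imp_div_less)+
  have Gh: "G l $$ (a, b) = cnj (G l $$ (b, a))" if "l < n" "a < k" "b < k" for l a b
    using G(2)[OF that(1)] that(2,3) unfolding psd_mat_def hermitian_mat_iff[OF G(1)[OF that(1)]]
    by blast
  have ent: "?B $$ (i * k + a, j * k + b) = (\<Sum>l<n. complex_of_real (c l * z l i * z l j) * G l $$ (a, b))"
    if "i < p" "j < p" "a < k" "b < k" for i j a b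
  proof -
    have lt: "i * k + a < p * k" if "i < p" "a < k" for i a
    proof -
      have "i * k + a < Suc i * k"
        using that by simp
      also have "\<dots> \<le> p * k"
        using that by (intro mult_le_mono1) simp
      finally show ?thesis .
    qed
    show ?thesis
      using that lt X[OF that] by (simp add: block_mat_def)
  qed
  show ?thesis
    unfolding psd_mat_def
  proof (intro conjI ballI)
    show "hermitian_mat ?B"
      unfolding hermitian_mat_iff[OF B]
    proof (intro allI impI)
      fix x y assume x: "x < p * k" and y: "y < p * k"
      \<comment> \<open>Exchanging \<open>x\<close> and \<open>y\<close> swaps the block numbers and
        the offsets. The first swap leaves the real coefficient unchanged, the second conjugates the
        entry of \<open>G l\<close>.\<close>
      show "?B $$ (y, x) = cnj (?B $$ (x, y))"
        using ent[OF dm(1)[OF x] dm(1)[OF y] dm(2)[OF x] dm(2)[OF y]]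
          ent[OF dm(1)[OF y] dm(1)[OF x] dm(2)[OF y] dm(2)[OF x]]
          Gh[OF _ dm(2)[OF y] dm(2)[OF x]]
        unfolding div_mult_mod_eq by (simp add: mult.assoc mult.left_commute)
    qed
    fix v :: "complex vec" assume "v \<in> carrier_vec (dim_row ?B)"
    then have v: "v \<in> carrier_vec (p * k)"
      using B by simp
    \<comment> \<open>Since the weights \<open>z l i\<close> are real, \<open>cnj\<close> passes
      through them, and the left and right factors of the form involve the same vector
      \<open>w l\<close>.\<close>
    define w where "w = (\<lambda>l. vec k (\<lambda>a. \<Sum>i<p. complex_of_real (z l i) * v $ (i * k + a)))"
    have "(?B *\<^sub>v v) \<bullet>c v = (\<Sum>i<p. \<Sum>a<k. \<Sum>j<p. \<Sum>b<k.
        cnj (v $ (i * k + a)) * ?B $$ (i * k + a, j * k + b) * v $ (j * k + b))"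
      unfolding cscalar_prod_mult_mat_vec[OF B v] sum_lessThan_mult ..
    also have "\<dots> = (\<Sum>i<p. \<Sum>a<k. \<Sum>j<p. \<Sum>b<k. \<Sum>l<n. complex_of_real (c l) *
        (cnj (z l i * v $ (i * k + a)) * G l $$ (a, b) * (z l j * v $ (j * k + b))))"
      by (intro sum.cong refl) (auto simp: ent sum_distrib_left sum_distrib_right mult_ac)
    \<comment> \<open>Only the order of summation changes: once \<open>l\<close>, \<open>a\<close>
      and \<open>b\<close> are outside, the sums over \<open>i\<close> and \<open>j\<close> separate
      and produce the components of \<open>w l\<close> at \<open>a\<close> (conjugated) and at
      \<open>b\<close>.\<close>
    also have "\<dots> = (\<Sum>l<n. \<Sum>a<k. \<Sum>b<k. \<Sum>i<p. \<Sum>j<p. complex_of_real (c l) *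
        (cnj (z l i * v $ (i * k + a)) * G l $$ (a, b) * (z l j * v $ (j * k + b))))"
      unfolding sum.cartesian_product
      by (rule sum.reindex_bij_witness[where i = "\<lambda>(l, a, b, i, j). (i, a, j, b, l)"
            and j = "\<lambda>(i, a, j, b, l). (l, a, b, i, j)"]) auto
    also have "\<dots> = (\<Sum>l<n. complex_of_real (c l) * ((G l *\<^sub>v w l) \<bullet>c w l))"
    proof (intro sum.cong refl)
      fix l assume l: "l \<in> {..<n}"
      have "w l \<in> carrier_vec k"
        by (simp add: w_def)
      then show "(\<Sum>a<k. \<Sum>b<k. \<Sum>i<p. \<Sum>j<p. complex_of_real (c l) *
          (cnj (z l i * v $ (i * k + a)) * G l $$ (a, b) * (z l j * v $ (j * k + b))))
        = complex_of_real (c l) * ((G l *\<^sub>v w l) \<bullet>c w l)"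
        using l cscalar_prod_mult_mat_vec[OF G(1)]
        by (simp add: w_def sum_distrib_left sum_distrib_right mult_ac)
    qed
    finally have "Re ((?B *\<^sub>v v) \<bullet>c v) = (\<Sum>l<n. c l * Re ((G l *\<^sub>v w l) \<bullet>c w l))"
      by simp
    also have "\<dots> \<ge> 0"
    proof (intro sum_nonneg mult_nonneg_nonneg)
      fix l assume "l \<in> {..<n}"
      then show "0 \<le> c l" "0 \<le> Re ((G l *\<^sub>v w l) \<bullet>c w l)"
        using c G[of l] unfolding psd_mat_def by (auto simp: w_def)
    qed
    finally show "0 \<le> Re ((?B *\<^sub>v v) \<bullet>c v)" .
  qed
qed

section \<open>Linear maps on finite linear combinations\<close>

text \<open>Induction on the number of terms, from additivity and homogeneity. Summation happens
  inside \<open>mat\<close>, so the empty sum is the \<open>n\<close> by \<open>n\<close> zero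
  matrix; the conclusion is entrywise, the form in which \<open>psd_block_mat_sum\<close> takes its
  blocks.\<close>

lemma linear_mat_map_sum_index:
  fixes c :: "nat \<Rightarrow> complex"
  assumes lin: "linear_mat_map n k \<Phi>"
    and E: "\<And>l. l < t \<Longrightarrow> E l \<in> carrier_mat n n" and ab: "a < k" "b < k"
  shows "\<Phi> (mat n n (\<lambda>xy. \<Sum>l<t. c l * E l $$ xy)) $$ (a, b)
       = (\<Sum>l<t. c l * \<Phi> (E l) $$ (a, b))"
  using E
proof (induction t)
  note L = lin[unfolded linear_mat_map_iff]
  case 0
  let ?Z = "mat n n (\<lambda>_. 0) :: complex mat"
  \<comment> \<open>The zero matrix is 0 times itself, so homogeneity forces its image to be
    zero.\<close>
  have "\<Phi> (0 \<cdot>\<^sub>m ?Z) = 0 \<cdot>\<^sub>m \<Phi> ?Z" and c: "\<Phi> ?Z \<in> carrier_mat k k"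
    using L by auto
  moreover have "0 \<cdot>\<^sub>m ?Z = ?Z"
    by (intro eq_matI) auto
  ultimately have "\<Phi> ?Z $$ (a, b) = (0 \<cdot>\<^sub>m \<Phi> ?Z) $$ (a, b)"
    by simp
  then show ?case
    using ab c by simp
next
  note L = lin[unfolded linear_mat_map_iff]
  case (Suc t)
  let ?S = "\<lambda>t. mat n n (\<lambda>xy. \<Sum>l<t. c l * E l $$ xy)"
  have Et: "E t \<in> carrier_mat n n"
    using Suc.prems by simp
  have "?S (Suc t) = ?S t + c t \<cdot>\<^sub>m E t"
    using Et by (intro eq_matI) auto
  then have "\<Phi> (?S (Suc t)) = \<Phi> (?S t) + c t \<cdot>\<^sub>m \<Phi> (E t)"
    using L Et by simp
  moreover have "\<Phi> (?S t) \<in> carrier_mat k k" "\<Phi> (E t) \<in> carrier_mat k k"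
    using L Et by auto
  ultimately show ?case
    using ab Suc by simp
qed

section \<open>Functional calculus for \<open>A\<close> and positivity of the block matrix\<close>

theorem theorem2p3:
  fixes n k r :: nat and m M :: real
    and \<Phi> :: "complex mat \<Rightarrow> complex mat" and A :: "complex mat"
  assumes "linear_mat_map n k \<Phi>"
    and "positive_mat_map n \<Phi>"
    and "unital_mat_map n k \<Phi>"
    and "A \<in> carrier_mat n n"
    and "hermitian_mat A"
    and "spectrum A \<subseteq> complex_of_real ` {m..M}"
  shows "psd_mat (block_mat (r + 1) k (\<lambda>i j.
           \<Phi> (A ^\<^sub>m (i + j - 2)
              * (A - complex_of_real m \<cdot>\<^sub>m 1\<^sub>m n)
              * (complex_of_real M \<cdot>\<^sub>m 1\<^sub>m n - A))))"
proof -
  note A = assms(4)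
  obtain U e where U: "U \<in> carrier_mat n n" and UU: "mat_adjoint U * U = 1\<^sub>m n"
    and AU: "A = U * mat_diag n e * mat_adjoint U"
    using hermitian_mat_diagonalization[OF A assms(5)] by blast
  note assoc = assoc_mult_mat[of _ n n _ n _ n]
  note mc = mult_carrier_mat[of _ n n _ n]
  have U': "mat_adjoint U \<in> carrier_mat n n"
    using U by simp
  have UU': "U * mat_adjoint U = 1\<^sub>m n"
    by (rule mat_mult_left_right_inverse[OF U' U UU])
  \<comment> \<open>\<open>S c\<close> is the functional calculus of \<open>A\<close>: the matrix
    with eigenvalue \<open>c l\<close> on the \<open>l\<close>-th column of \<open>U\<close>. Sums
    and products of such matrices act pointwise on \<open>c\<close>, so polynomials in
    \<open>A\<close> reduce to polynomials in \<open>e\<close>.\<close>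
  define S where "S = (\<lambda>c. U * mat_diag n c * mat_adjoint U)"
  have S: "S c \<in> carrier_mat n n" for c
    unfolding S_def using U U' by (intro mc) auto
  have S_index: "S c $$ (a, b) = (\<Sum>l<n. c l * (U $$ (a, l) * cnj (U $$ (b, l))))"
    if "a < n" "b < n" for c a b
    unfolding S_def by (rule mult_mat_diag_adjoint_index[OF U that])
  have S_mult: "S c * S d = S (\<lambda>l. c l * d l)" for c d
  proof -
    have "S c * S d = U * mat_diag n c * (mat_adjoint U * U) * mat_diag n d * mat_adjoint U"
      unfolding S_def using U U' by (simp add: assoc mc)
    also have "\<dots> = U * (mat_diag n c * mat_diag n d) * mat_adjoint U"
      unfolding UU using U U' by (simp add: assoc mc right_mult_one_mat[of _ n n])
    finally show ?thesis
      unfolding S_def by simp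
  qed
  have S_one: "1\<^sub>m n = S (\<lambda>_. 1)"
    unfolding S_def using U UU' by simp
  have AS: "A = S e"
    unfolding S_def by (rule AU)
  have A_pow: "A ^\<^sub>m q = S (\<lambda>l. e l ^ q)" for q
  proof (induction q)
    case 0
    then show ?case
      using A S_one by simp
  next
    case (Suc q)
    then show ?case
      by (simp add: S_mult AS[symmetric] flip: power_Suc2) (simp add: AS S_mult mult.commute)
  qed
  have A_m: "A - x \<cdot>\<^sub>m 1\<^sub>m n = S (\<lambda>l. e l - x)" and M_A: "x \<cdot>\<^sub>m 1\<^sub>m n - A = S (\<lambda>l. x - e l)" for x
  proof -
    have x: "x \<cdot>\<^sub>m 1\<^sub>m n = S (\<lambda>l. x)"
      unfolding S_one using carrier_matD[OF S]
      by (intro eq_matI) (auto simp: S_index sum_distrib_left)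
    show "A - x \<cdot>\<^sub>m 1\<^sub>m n = S (\<lambda>l. e l - x)" "x \<cdot>\<^sub>m 1\<^sub>m n - A = S (\<lambda>l. x - e l)"
      unfolding x unfolding AS using carrier_matD[OF S]
      by (auto intro!: eq_matI simp: S_index sum_subtractf left_diff_distrib)
  qed
  have poly: "A ^\<^sub>m q * (A - complex_of_real m \<cdot>\<^sub>m 1\<^sub>m n) * (complex_of_real M \<cdot>\<^sub>m 1\<^sub>m n - A)
      = S (\<lambda>l. e l ^ q * (e l - m) * (M - e l))" for q
    unfolding A_pow A_m M_A S_mult ..
  \<comment> \<open>The \<open>l\<close>-th column of \<open>U\<close> is an eigenvector for
    \<open>e l\<close>, so the hypothesis on the spectrum makes \<open>e l\<close> real and puts it
    in the interval.\<close>
  have "\<exists>x \<in> {m..M}. e l = complex_of_real x" if l: "l < n" for l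
  proof -
    have "A * U = U * mat_diag n e * (mat_adjoint U * U)"
      unfolding AU using U U' by (simp add: assoc mc)
    then have "A * U = U * mat_diag n e"
      unfolding UU using U by (simp add: right_mult_one_mat[of _ n n] mc)
    then have "A *\<^sub>v col U l = col (U * mat_diag n e) l"
      using col_mult2[OF A U l] by simp
    also have "\<dots> = e l \<cdot>\<^sub>v col U l"
      using l U by (intro eq_vecI) (auto simp: mat_diag_mult_right[OF U])
    finally have "A *\<^sub>v col U l = e l \<cdot>\<^sub>v col U l" .
    \<comment> \<open>Columns of \<open>U\<close> are unit vectors: the diagonal entries of
      \<open>mat_adjoint U * U\<close> are 1.\<close>
    moreover have "col U l \<noteq> 0\<^sub>v n"
    proof
      assume "col U l = 0\<^sub>v n"
      then have "(mat_adjoint U * U) $$ (l, l) = 0"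
        unfolding mat_adjoint_mult_index[OF U l l] using l U by (simp flip: index_col)
      then show False
        unfolding UU using l by simp
    qed
    ultimately have "e l \<in> spectrum A"
      using A col_carrier_vec[OF l U] unfolding spectrum_def eigenvalue_def eigenvector_def by auto
    then show ?thesis
      using assms(6) by auto
  qed
  then obtain x where x: "\<And>l. l < n \<Longrightarrow> x l \<in> {m..M} \<and> e l = complex_of_real (x l)"
    by metis
  \<comment> \<open>For \<open>l < n\<close>, \<open>E l\<close> is the orthogonal projection onto
    column \<open>l\<close> of \<open>U\<close>. In these terms \<open>S_E\<close> is the spectral
    decomposition, the form to which linearity of \<open>\<Phi>\<close> applies.\<close>
  define E where "E = (\<lambda>l. mat n n (\<lambda>(a, b). U $$ (a, l) * cnj (U $$ (b, l))))"
  have E: "E l \<in> carrier_mat n n" for l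
    by (simp add: E_def)
  have S_E: "S c = mat n n (\<lambda>ab. \<Sum>l<n. c l * E l $$ ab)" for c
    using S[of c] by (intro eq_matI) (auto simp: S_index E_def)
  have psd_E: "psd_mat (E l)" for l
    by (rule psd_mat_rank_one[OF E, of _ "\<lambda>a. U $$ (a, l)"]) (simp add: E_def)
  show ?thesis
  \<comment> \<open>The power with exponent \<open>i + j\<close> factors as
    \<open>x l ^ i * x l ^ j\<close>, which supplies the weights \<open>z\<close>; the remaining
    factor \<open>(x l - m) * (M - x l)\<close> is nonnegative on the interval.\<close>
  proof (rule psd_block_mat_sum[where n = n and c = "\<lambda>l. (x l - m) * (M - x l)"
        and z = "\<lambda>l i. x l ^ i" and G = "\<lambda>l. \<Phi> (E l)"])
    show "0 \<le> (x l - m) * (M - x l)" if "l < n" for l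
      using x[OF that] by simp
    show "\<Phi> (E l) \<in> carrier_mat k k" for l
      using assms(1) E unfolding linear_mat_map_iff by blast
    show "psd_mat (\<Phi> (E l))" for l
      using assms(2) E psd_E unfolding positive_mat_map_def by blast
    \<comment> \<open>Here \<open>i\<close> and \<open>j\<close> count from 0 while the blocks count
      from 1, so the exponent \<open>i + 1 + (j + 1) - 2\<close> is \<open>i + j\<close> and the
      truncated subtraction loses nothing.\<close>
    fix i j a b assume "a < k" "b < k"
    then show "\<Phi> (A ^\<^sub>m (i + 1 + (j + 1) - 2) * (A - complex_of_real m \<cdot>\<^sub>m 1\<^sub>m n)
          * (complex_of_real M \<cdot>\<^sub>m 1\<^sub>m n - A)) $$ (a, b)
        = (\<Sum>l<n. complex_of_real ((x l - m) * (M - x l) * x l ^ i * x l ^ j) * \<Phi> (E l) $$ (a, b))"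
      unfolding poly S_E linear_mat_map_sum_index[OF assms(1) E \<open>a < k\<close> \<open>b < k\<close>]
      using x by (intro sum.cong) (auto simp: power_add mult_ac)
  qed
qed

end
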